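(* Let $f\in C(\mathbb{S}^1)$ be non-constant, suppose that $\mathcal{T}(f)$ is a doubling metric space, and let $p\ge1$. There exists a constant $C>0$, independent of $\varepsilon$ and $r$, such that for all $\varepsilon>0$ there exists $r_0>0$ with \[ C^{-1}V_r^p(f)-\varepsilon\;\leq\; N_r(\mathcal{T}(f))\cdot r^p\;\leq\; C\,V_r^p(f)+\varepsilon \] for all $0<r<r_0$.
   Context: $\mathbb{S}^1=[0,1]/_{0\sim 1}$ is the circle and $C(\mathbb{S}^1)$ is the set of continuous real-valued functions on $\mathbb{S}^1$. Excursion functions and trees. An excursion function is a continuous $f:[0,1]\to[0,\infty)$ with $f(0)=f(1)=0$. For an excursion function $f$ and $0\le x\le y\le 1$ set $d_f(x,y)=d_f(y,x)=f(x)+f(y)-2\min_{z\in[x,y]}f(z)$. This is a pseudometric on $[0,1]$; identifying points at $d_f$-distance $0$ gives the metric space $\mathcal{T}(f)=([0,1]/_\sim,d_f)$, the real tree of $f$. A general $f\in C(\mathbb{S}^1)$ is identified with the excursion function $\widetilde f(x)=f(x+a)-f(a)$, where $a$ is a point at which $f$ attains its minimum; $\mathcal{T}(f)$ and $V_r^p(f)$ for $f\in C(\mathbb{S}^1)$ are understood as those of $\widetilde f$. Discretised variation. For $r>0$ and $p>0$, $V_r^p(f)=\sup\{\sum_{i=1}^{n-1}|f(x_i)-f(x_{i+1})|^p\}$, the supremum being over all finite partitions $x_1<\dots<x_n$ of points in $[0,1]$ with $|f(x_i)-f(x_{i+1})|=r$ for all $1\le i\le n-1$ (the value is $0$ if no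 such partition with $n\ge2$ exists). For a totally bounded metric space $(X,d)$, $N_r(X)$ denotes the maximal cardinality of an $r$-separated subset of $X$, where $A\subseteq X$ is $r$-separated if $d(x,y)>r$ for all distinct $x,y\in A$. *)

theory Defs
  imports "HOL-Analysis.Analysis"
begin

section \<open>Functions on the circle and excursion functions\<close>

text \<open>
  A continuous function on the circle (the interval \<open>[0,1]\<close> with \<open>0\<close> and \<open>1\<close> identified) is a
  continuous function on \<open>[0,1]\<close> with equal values at the end points. Values outside \<open>[0,1]\<close> are
  never used below.
\<close>

definition circle_fun :: "(real \<Rightarrow> real) \<Rightarrow> bool" where
  "circle_fun f \<longleftrightarrow> continuous_on {0..1} f \<and> f 0 = f 1"

definition excursion :: "(real \<Rightarrow> real) \<Rightarrow> bool" where
  "excursion f \<longleftrightarrow> continuous_on {0..1} f \<and> (\<forall>x\<in>{0..1}. 0 \<le> f x) \<and> f 0 = 0 \<and> f 1 = 0"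

text \<open>The argument \<open>x + a\<close> is taken on the circle, i.e. modulo \<open>1\<close>.\<close>

definition excursion_from :: "real \<Rightarrow> (real \<Rightarrow> real) \<Rightarrow> real \<Rightarrow> real" where
  "excursion_from a f x = f (frac (x + a)) - f a"

section \<open>The real tree of an excursion function\<close>

text \<open>
  For continuous \<open>f\<close> and \<open>x, y \<in> [0,1]\<close> the infimum is over a nonempty compact interval, hence it
  is a minimum.
\<close>

definition exc_dist :: "(real \<Rightarrow> real) \<Rightarrow> real \<Rightarrow> real \<Rightarrow> real" where
  "exc_dist f x y = f x + f y - 2 * (INF z\<in>{min x y..max x y}. f z)"

definition exc_rel :: "(real \<Rightarrow> real) \<Rightarrow> (real \<times> real) set" where
  "exc_rel f = {(x, y). x \<in> {0..1} \<and> y \<in> {0..1} \<and> exc_dist f x y = 0}"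

definition tree :: "(real \<Rightarrow> real) \<Rightarrow> real set set" where
  "tree f = {0..1} // exc_rel f"

text \<open>
  The choice of representatives is immaterial, see \<open>tree_dist_class\<close>. The value \<open>0\<close> outside the
  tree only serves the locale \<open>Metric_space\<close>, which wants a distance that is nonnegative and
  symmetric on the whole type.
\<close>

definition tree_dist :: "(real \<Rightarrow> real) \<Rightarrow> real set \<Rightarrow> real set \<Rightarrow> real" where
  "tree_dist f X Y =
     (if X \<in> tree f \<and> Y \<in> tree f then exc_dist f (SOME x. x \<in> X) (SOME y. y \<in> Y) else 0)"

section \<open>Discretised variation\<close>

definition step_sums :: "real \<Rightarrow> real \<Rightarrow> (real \<Rightarrow> real) \<Rightarrow> real set" where
  "step_sums r p f =
     {(\<Sum>i=1..n-1. \<bar>f (x i) - f (x (i + 1))\<bar> powr p) | (n::nat) (x :: nat \<Rightarrow> real).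
        n \<ge> 2 \<and> (\<forall>i\<in>{1..n}. x i \<in> {0..1}) \<and>
        (\<forall>i\<in>{1..n-1}. x i < x (i + 1) \<and> \<bar>f (x i) - f (x (i + 1))\<bar> = r)}"

text \<open>
  For continuous \<open>f\<close> and \<open>r > 0\<close> the set of sums is bounded above, see \<open>bdd_above_step_sums\<close>, so
  that the real supremum is meaningful.
\<close>

definition discr_var :: "real \<Rightarrow> real \<Rightarrow> (real \<Rightarrow> real) \<Rightarrow> real" where
  "discr_var r p f = (if step_sums r p f = {} then 0 else Sup (step_sums r p f))"

section \<open>Separated sets and doubling metric spaces\<close>

context Metric_space
begin

definition separated_by :: "real \<Rightarrow> 'a set \<Rightarrow> bool" where
  "separated_by r A \<longleftrightarrow> A \<subseteq> M \<and> (\<forall>x\<in>A. \<forall>y\<in>A. x \<noteq> y \<longrightarrow> d x y > r)"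

text \<open>
  If \<open>M\<close> is totally bounded and \<open>r > 0\<close>, then separated sets are finite and the maximum is over a
  finite set, see \<open>separated_by_bound\<close>.
\<close>

definition packing_number :: "real \<Rightarrow> nat" where
  "packing_number r = Max {card A | A. finite A \<and> separated_by r A}"

definition doubling :: bool where
  "doubling \<longleftrightarrow> (\<exists>K::nat. \<forall>x\<in>M. \<forall>r>0. \<exists>F. finite F \<and> F \<subseteq> M \<and> card F \<le> K \<and>
     mball x r \<subseteq> (\<Union>y\<in>F. mball y (r / 2)))"

lemma separated_by_bound:
  assumes "mtotally_bounded M" "r > 0"
  shows "\<exists>N. \<forall>A. separated_by r A \<longrightarrow> finite A \<and> card A \<le> N"
proof -
  obtain K where K: "finite K" "K \<subseteq> M" "M \<subseteq> (\<Union>x\<in>K. mball x (r / 2))"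
    using assms unfolding mtotally_bounded_def by (meson half_gt_zero)
  have "finite A \<and> card A \<le> card K" if A: "separated_by r A" for A
  proof -
    have "\<exists>k. k \<in> K \<and> a \<in> mball k (r / 2)" if "a \<in> A" for a
    proof -
      have "a \<in> M" using A that by (auto simp only: separated_by_def)
      then show ?thesis using K(3) by (auto simp only: UN_iff subset_iff Bex_def)
    qed
    then have "\<forall>a\<in>A. \<exists>k. k \<in> K \<and> a \<in> mball k (r / 2)" by (rule ballI)
    from bchoice[OF this] obtain g where "\<forall>a\<in>A. g a \<in> K \<and> a \<in> mball (g a) (r / 2)" ..
    then have g: "g a \<in> K" "a \<in> mball (g a) (r / 2)" if "a \<in> A" for a
      using that by blast+
    have "inj_on g A"
    proof (rule inj_onI, rule ccontr)
      fix a b assume ab: "a \<in> A" "b \<in> A" "g a = g b" "a \<noteq> b"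
      have "d (g a) a < r / 2" "d (g a) b < r / 2" "a \<in> M" "b \<in> M" "g a \<in> M"
        using g(2)[OF ab(1)] g(2)[OF ab(2)] unfolding ab(3) in_mball by blast+
      then have "d a b < r"
        using triangle[of a "g a" b] commute[of a "g a"] by linarith
      then show False
        using A ab unfolding separated_by_def by fastforce
    qed
    moreover have "g ` A \<subseteq> K" using g(1) by blast
    ultimately show ?thesis
      using inj_on_finite[OF _ _ K(1)] card_inj_on_le[OF _ _ K(1)] by blast
  qed
  then show ?thesis by blast
qed

lemma finite_packing_cards:
  assumes "mtotally_bounded M" "r > 0"
  shows "finite {card A | A. finite A \<and> separated_by r A}"
    and "{card A | A. finite A \<and> separated_by r A} \<noteq> {}"
proof -
  obtain N where "\<forall>A. separated_by r A \<longrightarrow> finite A \<and> card A \<le> N"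
    using separated_by_bound[OF assms] by blast
  then have "{card A | A. finite A \<and> separated_by r A} \<subseteq> {..N}" by auto
  then show "finite {card A | A. finite A \<and> separated_by r A}"
    using finite_subset by blast
  have "finite {} \<and> separated_by r {}" by (simp add: separated_by_def)
  then show "{card A | A. finite A \<and> separated_by r A} \<noteq> {}" by blast
qed

end

section \<open>Well-definedness\<close>

lemma excursion_excursion_from:
  assumes f: "circle_fun f" and a: "is_arg_min f (\<lambda>x. x \<in> {0..1}) a"
  shows "excursion (excursion_from a f)"
proof -
  have a01: "0 \<le> a" "a \<le> 1" and min: "\<And>x. x \<in> {0..1} \<Longrightarrow> f a \<le> f x"
    using a unfolding is_arg_min_def by (auto simp: not_less)
  have cf: "continuous_on {0..1} f" and f01: "f 0 = f 1"
    using f by (auto simp: circle_fun_def)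
  have *: "f (frac (x + a)) = (if x \<le> 1 - a then f (x + a) else f (x + a - 1))"
    if x: "x \<in> {0..1}" for x
  proof -
    consider "x + a < 1" | "x + a = 1" | "x + a > 1" "x + a < 2" | "x = 1" "a = 1"
      using x a01 by force
    then show ?thesis
    proof cases
      case 1
      then have "frac (x + a) = x + a" using x a01 by (simp add: frac_eq)
      then show ?thesis using 1 by simp
    next
      case 2 then show ?thesis using f01 by simp
    next
      case 3
      then have "frac (x + a) = x + a - 1"
        by (subst frac_unique_iff) auto
      then show ?thesis using 3 by simp
    next
      case 4
      then have "frac (x + a) = 0" by simp
      then show ?thesis unfolding \<open>frac (x + a) = 0\<close> using 4 f01 by simp
    qed
  qed
  have eq: "{0..1} = {0..1-a} \<union> {1-a..1::real}" using a01 by auto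
  have "continuous_on ({0..1-a} \<union> {1-a..1})
          (\<lambda>x. if x \<le> 1 - a then f (x + a) else f (x + a - 1))"
  proof (rule continuous_on_cases)
    show "continuous_on {0..1-a} (\<lambda>x. f (x + a))"
      by (rule continuous_on_compose2[OF cf]) (use a01 in \<open>auto intro!: continuous_intros\<close>)
    show "continuous_on {1-a..1} (\<lambda>x. f (x + a - 1))"
      by (rule continuous_on_compose2[OF cf]) (use a01 in \<open>auto intro!: continuous_intros\<close>)
  qed (use f01 in \<open>auto simp: le_less\<close>)
  then have "continuous_on {0..1} (\<lambda>x. f (frac (x + a)))"
    unfolding eq[symmetric] by (rule continuous_on_eq) (simp add: *)
  then have "continuous_on {0..1} (excursion_from a f)"
    unfolding excursion_from_def by (intro continuous_intros)
  moreover have "frac (x + a) \<in> {0..1}" for x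
    using frac_lt_1[of "x + a"] by (simp add: less_imp_le)
  moreover have "f (frac (0 + a)) = f a" "f (frac (1 + a)) = f a"
    using *[of 0] *[of 1] a01 f01 by (auto simp: le_less)
  ultimately show ?thesis
    unfolding excursion_def using min by (auto simp: excursion_from_def)
qed

context
  fixes f :: "real \<Rightarrow> real"
  assumes f: "excursion f"
begin

lemma exc_min:
  assumes "x \<in> {0..1}" "y \<in> {0..1}"
  obtains m where "m \<in> {min x y..max x y}" "(INF z\<in>{min x y..max x y}. f z) = f m"
    "\<And>z. z \<in> {min x y..max x y} \<Longrightarrow> f m \<le> f z"
proof -
  have "continuous_on {min x y..max x y} f"
    by (rule continuous_on_subset[of "{0..1}"]) (use f assms in \<open>auto simp: excursion_def\<close>)
  moreover have "x \<in> {min x y..max x y}" by simp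
  ultimately obtain m
    where m: "m \<in> {min x y..max x y}" "\<forall>z\<in>{min x y..max x y}. f m \<le> f z"
    using continuous_attains_inf[of "{min x y..max x y}" f] compact_Icc by blast
  then have "(INF z\<in>{min x y..max x y}. f z) = f m"
    by (intro cInf_eq_minimum) auto
  with m that show thesis by blast
qed

lemma exc_dist_commute: "exc_dist f x y = exc_dist f y x"
  unfolding exc_dist_def by (simp add: min.commute max.commute)

lemma exc_dist_nonneg:
  assumes "x \<in> {0..1}" "y \<in> {0..1}"
  shows "0 \<le> exc_dist f x y"
proof -
  obtain m where "(INF z\<in>{min x y..max x y}. f z) = f m"
    "\<And>z. z \<in> {min x y..max x y} \<Longrightarrow> f m \<le> f z" using exc_min[OF assms] by metis
  then show ?thesis unfolding exc_dist_def by (smt (verit) atLeastAtMost_iff)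
qed

lemma exc_dist_self [simp]: "exc_dist f x x = 0"
  unfolding exc_dist_def by simp

lemma exc_dist_triangle:
  assumes "x \<in> {0..1}" "y \<in> {0..1}" "z \<in> {0..1}"
  shows "exc_dist f x z \<le> exc_dist f x y + exc_dist f y z"
proof -
  obtain a where a: "(INF z\<in>{min x y..max x y}. f z) = f a"
    "\<And>z. z \<in> {min x y..max x y} \<Longrightarrow> f a \<le> f z" using exc_min[of x y] assms by metis
  obtain b where b: "(INF t\<in>{min y z..max y z}. f t) = f b"
    "\<And>t. t \<in> {min y z..max y z} \<Longrightarrow> f b \<le> f t" using exc_min[of y z] assms by metis
  obtain c where c: "c \<in> {min x z..max x z}" "(INF t\<in>{min x z..max x z}. f t) = f c"
    using exc_min[of x z] assms by metis
  have "f a \<le> f y" "f b \<le> f y" using a(2) b(2) by auto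
  moreover have "c \<in> {min x y..max x y} \<or> c \<in> {min y z..max y z}"
    using c(1) by (auto simp: min_def max_def split: if_splits)
  then have "f a \<le> f c \<or> f b \<le> f c" using a(2) b(2) by blast
  ultimately show ?thesis unfolding exc_dist_def a(1) b(1) c(2) by linarith
qed

lemma equiv_exc_rel: "equiv {0..1} (exc_rel f)"
proof (rule equivI)
  show "exc_rel f \<subseteq> {0..1} \<times> {0..1}" by (auto simp: exc_rel_def)
  show "refl_on {0..1} (exc_rel f)" by (auto simp: refl_on_def exc_rel_def)
  show "sym (exc_rel f)" by (auto simp: sym_def exc_rel_def exc_dist_commute)
  show "trans (exc_rel f)"
  proof (rule transI)
    fix x y z assume "(x, y) \<in> exc_rel f" "(y, z) \<in> exc_rel f"
    then show "(x, z) \<in> exc_rel f"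
      using exc_dist_triangle[of x y z] exc_dist_nonneg[of x z] by (auto simp: exc_rel_def)
  qed
qed

lemma exc_dist_cong:
  assumes "(x, x') \<in> exc_rel f" "(y, y') \<in> exc_rel f"
  shows "exc_dist f x y = exc_dist f x' y'"
proof -
  have *: "x \<in> {0..1}" "x' \<in> {0..1}" "y \<in> {0..1}" "y' \<in> {0..1}"
    "exc_dist f x x' = 0" "exc_dist f y y' = 0"
    using assms by (auto simp: exc_rel_def)
  show ?thesis
    using * exc_dist_triangle[of x x' y] exc_dist_triangle[of x' y' y]
      exc_dist_triangle[of x' x y'] exc_dist_triangle[of x y y']
      exc_dist_commute[of x x'] exc_dist_commute[of y y'] by linarith
qed

lemma tree_dist_class:
  assumes "x \<in> {0..1}" "y \<in> {0..1}"
  shows "tree_dist f (exc_rel f `` {x}) (exc_rel f `` {y}) = exc_dist f x y"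
proof -
  have "exc_rel f `` {x} \<in> tree f" "exc_rel f `` {y} \<in> tree f"
    using assms by (auto simp: tree_def intro: quotientI)
  moreover have "(SOME v. v \<in> exc_rel f `` {u}) \<in> exc_rel f `` {u}" if "u \<in> {0..1}" for u
    using equiv_class_self[OF equiv_exc_rel that] by (rule someI)
  from this[OF assms(1)] this[OF assms(2)]
  have "(x, SOME u. u \<in> exc_rel f `` {x}) \<in> exc_rel f"
    "(y, SOME u. u \<in> exc_rel f `` {y}) \<in> exc_rel f"
    by (simp_all only: Image_singleton_iff)
  ultimately show ?thesis
    unfolding tree_dist_def by (simp only: if_True simp_thms exc_dist_cong[symmetric])
qed

lemma tree_cases:
  assumes "X \<in> tree f"
  obtains x where "x \<in> {0..1}" "X = exc_rel f `` {x}"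
  using assms unfolding tree_def by (elim quotientE)

lemma Metric_space_tree: "Metric_space (tree f) (tree_dist f)"
proof
  fix X Y
  show "0 \<le> tree_dist f X Y"
  proof (cases "X \<in> tree f \<and> Y \<in> tree f")
    case True
    then obtain x y where "x \<in> {0..1}" "y \<in> {0..1}" "X = exc_rel f `` {x}" "Y = exc_rel f `` {y}"
      by (metis tree_cases)
    then show ?thesis by (simp only: tree_dist_class exc_dist_nonneg)
  next
    case False
    then show ?thesis by (simp only: tree_dist_def if_False order_refl)
  qed
  show "tree_dist f X Y = tree_dist f Y X"
    unfolding tree_dist_def by (auto simp: exc_dist_commute)
next
  fix X Y assume "X \<in> tree f" "Y \<in> tree f"
  then obtain x y where xy: "x \<in> {0..1}" "y \<in> {0..1}" "X = exc_rel f `` {x}" "Y = exc_rel f `` {y}"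
    by (metis tree_cases)
  have "X = Y \<longleftrightarrow> (x, y) \<in> exc_rel f"
    unfolding xy by (rule eq_equiv_class_iff[OF equiv_exc_rel xy(1,2)])
  also have "\<dots> \<longleftrightarrow> exc_dist f x y = 0" using xy by (auto simp: exc_rel_def)
  finally show "tree_dist f X Y = 0 \<longleftrightarrow> X = Y"
    unfolding xy(3,4) by (simp only: tree_dist_class[OF xy(1,2)])
next
  fix X Y Z assume "X \<in> tree f" "Y \<in> tree f" "Z \<in> tree f"
  then obtain x y z where "x \<in> {0..1}" "y \<in> {0..1}" "z \<in> {0..1}"
    "X = exc_rel f `` {x}" "Y = exc_rel f `` {y}" "Z = exc_rel f `` {z}"
    by (metis tree_cases)
  then show "tree_dist f X Z \<le> tree_dist f X Y + tree_dist f Y Z"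
    by (simp only: tree_dist_class exc_dist_triangle)
qed

lemma exc_unif:
  assumes "e > 0"
  obtains \<delta> where "\<delta> > 0"
    "\<And>x y. x \<in> {0..1} \<Longrightarrow> y \<in> {0..1} \<Longrightarrow> \<bar>x - y\<bar> < \<delta> \<Longrightarrow> \<bar>f x - f y\<bar> < e"
proof -
  have "uniformly_continuous_on {0..1} f"
    using f by (auto simp: excursion_def intro: compact_uniformly_continuous)
  then show thesis
    using assms that unfolding uniformly_continuous_on_def dist_real_def by metis
qed

lemma mtotally_bounded_tree: "Metric_space.mtotally_bounded (tree f) (tree_dist f) (tree f)"
proof -
  interpret T: Metric_space "tree f" "tree_dist f" by (rule Metric_space_tree)
  show ?thesis
    unfolding T.mtotally_bounded_def
  proof (intro allI impI)
    fix e :: real assume "e > 0"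
    then obtain \<delta> where \<delta>: "\<delta> > 0"
      "\<And>x y. x \<in> {0..1} \<Longrightarrow> y \<in> {0..1} \<Longrightarrow> \<bar>x - y\<bar> < \<delta> \<Longrightarrow> \<bar>f x - f y\<bar> < e / 2"
      using exc_unif[of "e / 2"] by auto
    have near: "exc_dist f x y < e"
      if xy: "x \<in> {0..1}" "y \<in> {0..1}" "\<bar>x - y\<bar> < \<delta>" for x y
    proof -
      obtain m where m: "m \<in> {min x y..max x y}" "(INF z\<in>{min x y..max x y}. f z) = f m"
        using exc_min[OF xy(1,2)] by metis
      have "m \<in> {0..1}" "\<bar>x - m\<bar> < \<delta>" "\<bar>y - m\<bar> < \<delta>"
        using xy m(1) by (auto simp: min_def max_def split: if_splits)
      then have "\<bar>f x - f m\<bar> < e / 2" "\<bar>f y - f m\<bar> < e / 2" using xy \<delta>(2) by auto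
      then show ?thesis unfolding exc_dist_def m(2) by linarith
    qed
    obtain k where k: "finite k" "k \<subseteq> {0..1}" "{0..1::real} \<subseteq> (\<Union>x\<in>k. ball x \<delta>)"
      using seq_compact_imp_totally_bounded[of "{0..1::real}"] \<delta>(1)
        compact_imp_seq_compact[OF compact_Icc[of 0 "1::real"]] by blast
    show "\<exists>K. finite K \<and> K \<subseteq> tree f \<and> tree f \<subseteq> (\<Union>x\<in>K. T.mball x e)"
    proof (intro exI conjI)
      show "finite ((\<lambda>x. exc_rel f `` {x}) ` k)" using k by simp
      show "(\<lambda>x. exc_rel f `` {x}) ` k \<subseteq> tree f"
        using k by (auto simp: tree_def intro: quotientI)
      show "tree f \<subseteq> (\<Union>x\<in>(\<lambda>x. exc_rel f `` {x}) ` k. T.mball x e)"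
      proof
        fix Y assume Y: "Y \<in> tree f"
        then obtain y where y: "y \<in> {0..1}" "Y = exc_rel f `` {y}" by (metis tree_cases)
        then obtain x where x: "x \<in> k" "\<bar>x - y\<bar> < \<delta>"
          using k(3) by (auto simp: dist_real_def)
        have x01: "x \<in> {0..1}" using x k by auto
        have "exc_rel f `` {x} \<in> tree f"
          using x01 by (auto simp: tree_def intro: quotientI)
        then have "Y \<in> T.mball (exc_rel f `` {x}) e"
          using Y near[OF x01 y(1) x(2)] tree_dist_class[OF x01 y(1)] y(2) by simp
        then show "Y \<in> (\<Union>x\<in>(\<lambda>x. exc_rel f `` {x}) ` k. T.mball x e)" using x by blast
      qed
    qed
  qed
qed

lemma bdd_above_step_sums:
  assumes "r > 0"
  shows "bdd_above (step_sums r p f)"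
proof -
  obtain \<delta> where \<delta>: "\<delta> > 0"
    "\<And>x y. x \<in> {0..1} \<Longrightarrow> y \<in> {0..1} \<Longrightarrow> \<bar>x - y\<bar> < \<delta> \<Longrightarrow> \<bar>f x - f y\<bar> < r"
    using exc_unif[OF assms] by auto
  have "(\<Sum>i=1..n-1. \<bar>f (x i) - f (x (i + 1))\<bar> powr p) \<le> (1 / \<delta>) * r powr p"
    if n: "n \<ge> 2" and x: "\<forall>i\<in>{1..n}. x i \<in> {0..1}"
      and s: "\<forall>i\<in>{1..n-1}. x i < x (i + 1) \<and> \<bar>f (x i) - f (x (i + 1))\<bar> = r" for n and x :: "nat \<Rightarrow> real"
  proof -
    have "x 1 + real k * \<delta> \<le> x (1 + k)" if "k \<le> n - 1" for k
      using that
    proof (induction k)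
      case (Suc k)
      have i: "1 + k \<in> {1..n-1}" "1 + k \<in> {1..n}" "1 + k + 1 \<in> {1..n}"
        using Suc.prems n by auto
      then have "\<not> \<bar>x (1 + k) - x (1 + k + 1)\<bar> < \<delta>" "x (1 + k) < x (1 + k + 1)"
        using s x \<delta>(2) by (metis less_irrefl)+
      then show ?case using Suc by (auto simp: algebra_simps)
    qed simp
    from this[of "n - 1"] have "x 1 + real (n - 1) * \<delta> \<le> x n" using n by simp
    moreover have "0 \<le> x 1" "x n \<le> 1" using x n by auto
    ultimately have "real (n - 1) \<le> 1 / \<delta>" using \<delta>(1) by (simp add: field_simps)
    moreover have "(\<Sum>i=1..n-1. \<bar>f (x i) - f (x (i + 1))\<bar> powr p) = real (n - 1) * r powr p"
      using s by simp
    ultimately show ?thesis by (simp only: mult_right_mono powr_ge_zero)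
  qed
  then show ?thesis unfolding step_sums_def by (auto intro!: bdd_aboveI)
qed

end

end

theory Submission
  imports Defs
begin

text \<open>
  Let \<open>M r\<close> be the largest number of steps of a partition whose increments all have size \<open>r\<close>, so
  that the discretised variation is \<open>M r * r powr p\<close>, and let \<open>N r\<close> be the packing number of the
  tree. The power \<open>r powr p\<close> is a common factor, so it suffices to compare \<open>M r\<close> with \<open>N r\<close> up to
  a constant factor that depends on the doubling constant only.

  Steps give separated points. An upward step from \<open>u\<close> to \<open>v\<close> separates \<open>v\<close> in the tree from
  everything before \<open>u\<close>: a path from there to \<open>v\<close> descends at least to height \<open>g u = g v - r\<close>. So
  the upper ends of the upward steps are pairwise at distance at least \<open>r\<close>, and so are the upper
  ends of the downward steps. One of the two families contains half of all steps
  (\<open>step_count_le_packing_number\<close>).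

  Separated points give steps. If \<open>t < t'\<close> are at distance more than \<open>4 * r\<close>, then \<open>g\<close> oscillates by
  more than \<open>2 * r\<close> on \<open>[t, t']\<close>, so whatever value a partition has reached by time \<open>t\<close>, the function
  reaches a distance of at least \<open>r\<close> from that value during \<open>[t, t']\<close>, and one more step of size exactly
  \<open>r\<close> fits in. Hence \<open>N (4 * r) - 1 \<le> M r\<close> (\<open>steps_through_separated_points\<close>).

  In a doubling space a change of scale by a bounded factor changes the packing number by a bounded
  factor only (\<open>card_le_packing_number_coarser\<close>). This replaces \<open>N (4 * r)\<close> by \<open>N r\<close>, and it also
  bridges the gap between distances at least \<open>r\<close> and distances larger than \<open>r\<close>. Finally, \<open>N (4 * r)\<close>
  is at least \<open>2\<close> for small \<open>r\<close> since \<open>g\<close> is not constant, which absorbs the \<open>- 1\<close>.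
\<close>

section \<open>Packing numbers of doubling spaces\<close>

context Metric_space
begin

lemma packing_number_attained:
  assumes "mtotally_bounded M" "r > 0"
  obtains A where "finite A" "separated_by r A" "card A = packing_number r"
proof -
  have "packing_number r \<in> {card A | A. finite A \<and> separated_by r A}"
    unfolding packing_number_def by (rule Max_in[OF finite_packing_cards[OF assms]])
  then show thesis using that by auto
qed

lemma card_le_packing_number:
  assumes "mtotally_bounded M" "r > 0" "finite A" "separated_by r A"
  shows "card A \<le> packing_number r"
  unfolding packing_number_def
  by (rule Max_ge[OF finite_packing_cards(1)[OF assms(1,2)]]) (use assms in auto)

definition doubling_with :: "nat \<Rightarrow> bool" where
  "doubling_with K \<longleftrightarrow> (\<forall>x\<in>M. \<forall>r>0. \<exists>F. finite F \<and> F \<subseteq> M \<and> card F \<le> K \<and>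
     mball x r \<subseteq> (\<Union>y\<in>F. mball y (r / 2)))"

lemma doubling_obtains:
  assumes doubling
  obtains K where "doubling_with K" "K \<ge> 1"
proof -
  obtain K where K: "doubling_with K"
    using assms unfolding doubling_def doubling_with_def by blast
  have "doubling_with (max K 1)"
    using K unfolding doubling_with_def by (meson le_max_iff_disj)
  then show thesis using that[of "max K 1"] by simp
qed

lemma doubling_cover:
  assumes K: "doubling_with K" and "x \<in> M" "\<rho> > 0"
  shows "\<exists>F. finite F \<and> F \<subseteq> M \<and> card F \<le> K ^ j \<and> mball x \<rho> \<subseteq> (\<Union>y\<in>F. mball y (\<rho> / 2 ^ j))"
proof (induction j)
  case 0
  show ?case using assms by (intro exI[of _ "{x}"]) auto
next
  case (Suc j)
  then obtain F where F: "finite F" "F \<subseteq> M" "card F \<le> K ^ j"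
    "mball x \<rho> \<subseteq> (\<Union>y\<in>F. mball y (\<rho> / 2 ^ j))" by blast
  have "\<rho> / 2 ^ j > 0" using \<open>\<rho> > 0\<close> by simp
  then have "\<forall>y\<in>F. \<exists>G. finite G \<and> G \<subseteq> M \<and> card G \<le> K \<and>
      mball y (\<rho> / 2 ^ j) \<subseteq> (\<Union>z\<in>G. mball z (\<rho> / 2 ^ j / 2))"
    using K F(2) unfolding doubling_with_def by blast
  then obtain G where G: "\<And>y. y \<in> F \<Longrightarrow> finite (G y) \<and> G y \<subseteq> M \<and> card (G y) \<le> K \<and>
      mball y (\<rho> / 2 ^ j) \<subseteq> (\<Union>z\<in>G y. mball z (\<rho> / 2 ^ j / 2))" by metis
  have "card (\<Union>y\<in>F. G y) \<le> (\<Sum>y\<in>F. card (G y))" by (rule card_UN_le[OF F(1)])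
  also have "\<dots> \<le> card F * K" using sum_bounded_above[of F "\<lambda>y. card (G y)" K] G by simp
  also have "\<dots> \<le> K ^ Suc j" using F(3) by simp
  finally have c: "card (\<Union>y\<in>F. G y) \<le> K ^ Suc j" .
  have "mball x \<rho> \<subseteq> (\<Union>z\<in>(\<Union>y\<in>F. G y). mball z (\<rho> / 2 ^ Suc j))"
  proof
    fix a assume "a \<in> mball x \<rho>"
    then obtain y where y: "y \<in> F" "a \<in> mball y (\<rho> / 2 ^ j)" using F(4) by blast
    then obtain z where "z \<in> G y" "a \<in> mball z (\<rho> / 2 ^ j / 2)" using G[OF y(1)] by blast
    then show "a \<in> (\<Union>z\<in>(\<Union>y\<in>F. G y). mball z (\<rho> / 2 ^ Suc j))"
      using y(1) by (auto simp: field_simps)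
  qed
  with c F(1) G show ?case by (intro exI[of _ "\<Union>y\<in>F. G y"]) auto
qed

text \<open>
  A ball of the covering has radius at most \<open>s / 2\<close>, so it contains at most one point of a set whose
  points are at pairwise distance at least \<open>s\<close>.
\<close>

lemma card_separated_in_mball:
  assumes K: "doubling_with K" and x: "x \<in> M" and \<rho>: "\<rho> > 0"
    and A: "A \<subseteq> mball x \<rho>" "\<And>a b. a \<in> A \<Longrightarrow> b \<in> A \<Longrightarrow> a \<noteq> b \<Longrightarrow> s \<le> d a b"
    and s: "2 * \<rho> \<le> 2 ^ j * s"
  shows "card A \<le> K ^ j"
proof -
  obtain F where F: "finite F" "F \<subseteq> M" "card F \<le> K ^ j"
    "mball x \<rho> \<subseteq> (\<Union>y\<in>F. mball y (\<rho> / 2 ^ j))" using doubling_cover[OF K x \<rho>] by metis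
  have "\<forall>a\<in>A. \<exists>y. y \<in> F \<and> a \<in> mball y (\<rho> / 2 ^ j)" using A(1) F(4) by blast
  then obtain h where h: "\<And>a. a \<in> A \<Longrightarrow> h a \<in> F" "\<And>a. a \<in> A \<Longrightarrow> a \<in> mball (h a) (\<rho> / 2 ^ j)"
    by metis
  have "inj_on h A"
  proof (rule inj_onI, rule ccontr)
    fix a b assume ab: "a \<in> A" "b \<in> A" "h a = h b" "a \<noteq> b"
    have "d (h a) a < \<rho> / 2 ^ j" "d (h a) b < \<rho> / 2 ^ j" "a \<in> M" "b \<in> M" "h a \<in> M"
      using h(2)[OF ab(1)] h(2)[OF ab(2)] unfolding ab(3) in_mball by blast+
    then have "d a b < 2 * \<rho> / 2 ^ j"
      using triangle[of a "h a" b] commute[of a "h a"] by simp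
    also have "\<dots> \<le> s" using s by (simp add: field_simps)
    finally show False using A(2)[OF ab(1,2,4)] by simp
  qed
  moreover have "h ` A \<subseteq> F" using h(1) by blast
  ultimately show ?thesis using card_inj_on_le[OF _ _ F(1)] F(3) by (meson le_trans)
qed

text \<open>
  A maximal \<open>R\<close>-separated subset of \<open>A\<close> is an \<open>R\<close>-net in \<open>A\<close>, and each ball around a point of the net
  contains boundedly many points of \<open>A\<close>. The hypothesis on \<open>A\<close> is a weak inequality, while
  \<^const>\<open>separated_by\<close> asks for a strict one.
\<close>

lemma card_le_packing_number_coarser:
  assumes K: "doubling_with K" and tb: "mtotally_bounded M" and R: "R > 0"
    and A: "finite A" "A \<subseteq> M" "\<And>a b. a \<in> A \<Longrightarrow> b \<in> A \<Longrightarrow> a \<noteq> b \<Longrightarrow> s \<le> d a b"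
    and s: "4 * R \<le> 2 ^ j * s"
  shows "card A \<le> packing_number R * K ^ j"
proof -
  let ?S = "{B. B \<subseteq> A \<and> separated_by R B}"
  have "finite ?S" using A(1) by simp
  moreover have "{} \<in> ?S" by (simp add: separated_by_def)
  ultimately have "\<exists>B\<in>?S. \<forall>B'\<in>?S. B \<subseteq> B' \<longrightarrow> B = B'"
    by (intro finite_has_maximal) auto
  then obtain B where B: "B \<in> ?S" "\<And>B'. B' \<in> ?S \<Longrightarrow> B \<subseteq> B' \<Longrightarrow> B = B'"
    by (elim bexE) simp
  have BA: "B \<subseteq> A" "separated_by R B" "finite B"
    using B(1) A(1) by (auto intro: finite_subset)
  have "\<exists>b\<in>B. a \<in> mball b (2 * R)" if a: "a \<in> A" for a
  proof (rule ccontr)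
    assume *: "\<not> ?thesis"
    have far: "R < d b a" "R < d a b" if b: "b \<in> B" for b
    proof -
      have "b \<in> M" "a \<in> M" using b a BA(1) A(2) by blast+
      moreover have "a \<notin> mball b (2 * R)" using * b by blast
      ultimately show "R < d b a" "R < d a b" using R commute[of a b] by (simp_all add: in_mball)
    qed
    have "a \<notin> B" using far[of a] mdist_zero[of a] a A(2) R by auto
    moreover have "insert a B \<in> ?S"
      using BA far a A(2) unfolding separated_by_def by auto
    ultimately show False using B(2) by blast
  qed
  then have "A = (\<Union>b\<in>B. A \<inter> mball b (2 * R))" by blast
  then have "card A \<le> (\<Sum>b\<in>B. card (A \<inter> mball b (2 * R)))"
    using card_UN_le[OF BA(3)] by metis
  also have "\<dots> \<le> card B * K ^ j"
  proof -
    have "card (A \<inter> mball b (2 * R)) \<le> K ^ j" if "b \<in> B" for b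
      by (rule card_separated_in_mball[OF K, of b "2 * R" _ s]) (use that BA(1) A R s in auto)
    then show ?thesis using sum_bounded_above[of B _ "K ^ j"] by simp
  qed
  also have "\<dots> \<le> packing_number R * K ^ j"
    using card_le_packing_number[OF tb R BA(3,2)] by simp
  finally show ?thesis .
qed

end

section \<open>Distances in the tree of an excursion\<close>

context
  fixes g :: "real \<Rightarrow> real"
  assumes g: "excursion g"
begin

lemma exc_dist_ge:
  assumes "x \<in> {0..1}" "y \<in> {0..1}" "x \<le> m" "m \<le> y"
  shows "g x + g y - 2 * g m \<le> exc_dist g x y"
proof -
  obtain c where "(INF z\<in>{min x y..max x y}. g z) = g c"
    "\<And>z. z \<in> {min x y..max x y} \<Longrightarrow> g c \<le> g z" using exc_min[OF g assms(1,2)] by metis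
  then show ?thesis unfolding exc_dist_def using assms by auto
qed

lemma exc_class_in_tree: "x \<in> {0..1} \<Longrightarrow> exc_rel g `` {x} \<in> tree g"
  by (auto simp: tree_def intro: quotientI)

lemma card_points_le_packing_number:
  assumes K: "Metric_space.doubling_with (tree g) (tree_dist g) K"
    and R: "R > 0" and s: "0 < s" "4 * R \<le> 2 ^ j * s"
    and I: "finite I" "t ` I \<subseteq> {0..1}"
    and far: "\<And>i k. i \<in> I \<Longrightarrow> k \<in> I \<Longrightarrow> i \<noteq> k \<Longrightarrow> s \<le> exc_dist g (t i) (t k)"
  shows "card I \<le> Metric_space.packing_number (tree g) (tree_dist g) R * K ^ j"
proof -
  interpret T: Metric_space "tree g" "tree_dist g" by (rule Metric_space_tree[OF g])
  let ?c = "\<lambda>i. exc_rel g `` {t i}"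
  have far': "s \<le> tree_dist g (?c i) (?c k)" if "i \<in> I" "k \<in> I" "i \<noteq> k" for i k
  proof -
    have "t i \<in> {0..1}" "t k \<in> {0..1}" using that I(2) by blast+
    then show ?thesis using far[OF that] by (simp only: tree_dist_class[OF g])
  qed
  have "?c ` I \<subseteq> tree g" using I exc_class_in_tree by blast
  have "inj_on ?c I"
  proof (rule inj_onI, rule ccontr)
    fix i k assume ik: "i \<in> I" "k \<in> I" "?c i = ?c k" "i \<noteq> k"
    have "?c k \<in> tree g" using ik \<open>?c ` I \<subseteq> tree g\<close> by blast
    then have "tree_dist g (?c i) (?c k) = 0" using T.zero[of "?c k" "?c k"] unfolding ik(3) by blast
    then show False using far'[OF ik(1,2,4)] s(1) by linarith
  qed
  then have "card I = card (?c ` I)" by (simp only: card_image)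
  also have "\<dots> \<le> T.packing_number R * K ^ j"
    by (rule T.card_le_packing_number_coarser[OF K mtotally_bounded_tree[OF g] R _ _ _ s(2)])
      (use I(1) \<open>?c ` I \<subseteq> tree g\<close> far' in blast)+
  finally show ?thesis .
qed

lemma packing_number_points:
  assumes R: "R > 0"
  obtains S where "finite S" "S \<subseteq> {0..1}"
    "card S = Metric_space.packing_number (tree g) (tree_dist g) R"
    "\<And>x y. x \<in> S \<Longrightarrow> y \<in> S \<Longrightarrow> x \<noteq> y \<Longrightarrow> R < exc_dist g x y"
proof -
  interpret T: Metric_space "tree g" "tree_dist g" by (rule Metric_space_tree[OF g])
  obtain A where A: "finite A" "T.separated_by R A" "card A = T.packing_number R"
    using T.packing_number_attained[OF mtotally_bounded_tree[OF g] R] by blast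
  have sep: "A \<subseteq> tree g" "\<And>X Y. X \<in> A \<Longrightarrow> Y \<in> A \<Longrightarrow> X \<noteq> Y \<Longrightarrow> R < tree_dist g X Y"
    using A(2) unfolding T.separated_by_def by blast+
  then have "\<forall>X\<in>A. \<exists>x. x \<in> {0..1} \<and> X = exc_rel g `` {x}" by (metis subsetD tree_cases[OF g])
  then obtain h where h: "\<And>X. X \<in> A \<Longrightarrow> h X \<in> {0..1}" "\<And>X. X \<in> A \<Longrightarrow> X = exc_rel g `` {h X}"
    by metis
  have inj: "inj_on h A" using h(2) by (metis inj_onI)
  have far: "R < exc_dist g x y" if xy: "x \<in> h ` A" "y \<in> h ` A" "x \<noteq> y" for x y
  proof -
    obtain X Y where XY: "X \<in> A" "Y \<in> A" "x = h X" "y = h Y" "X \<noteq> Y" using xy by blast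
    have "exc_dist g x y = tree_dist g X Y"
      using tree_dist_class[OF g h(1)[OF XY(1)] h(1)[OF XY(2)]]
        h(2)[OF XY(1)] h(2)[OF XY(2)] XY(3,4) by metis
    then show ?thesis using sep(2)[OF XY(1,2,5)] by simp
  qed
  show thesis
  proof (rule that)
    show "finite (h ` A)" using A(1) by simp
    show "h ` A \<subseteq> {0..1}" using h(1) by blast
    show "card (h ` A) = T.packing_number R" using A(3) card_image[OF inj] by simp
  qed (rule far)
qed

section \<open>Partitions with steps of a fixed size\<close>

definition equal_steps :: "real \<Rightarrow> nat \<Rightarrow> (nat \<Rightarrow> real) \<Rightarrow> bool" where
  "equal_steps r n x \<longleftrightarrow> (\<forall>i\<in>{1..n}. x i \<in> {0..1}) \<and>
     (\<forall>i\<in>{1..n-1}. x i < x (i + 1) \<and> \<bar>g (x i) - g (x (i + 1))\<bar> = r)"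

lemma step_sums_eq:
  "step_sums r p g = {real (n - 1) * r powr p | n x. n \<ge> 2 \<and> equal_steps r n x}"
proof -
  have "(\<Sum>i=1..n-1. \<bar>g (x i) - g (x (i + 1))\<bar> powr p) = real (n - 1) * r powr p"
    if "equal_steps r n x" for n x
    using that by (simp add: equal_steps_def)
  then show ?thesis unfolding step_sums_def equal_steps_def[symmetric] by force
qed

lemma equal_steps_mono:
  assumes "equal_steps r n x" "1 \<le> i" "i \<le> k" "k \<le> n"
  shows "x i \<le> x k"
  using assms(3,4)
proof (induction k rule: dec_induct)
  case (step k)
  then have "x k < x (k + 1)" using assms(1,2) by (auto simp: equal_steps_def)
  then show ?case using step by simp
qed simp

text \<open>
  Between two upper ends \<open>g\<close> drops by \<open>r\<close> below the later one in the case of upward steps, and below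
  the earlier one in the case of downward steps. Either way this bounds the distance from below.
\<close>

lemma step_count_le_packing_number:
  assumes K: "Metric_space.doubling_with (tree g) (tree_dist g) K"
    and r: "r > 0" and x: "equal_steps r n x"
  shows "n - 1 \<le> 2 * (Metric_space.packing_number (tree g) (tree_dist g) r * K ^ 2)"
proof -
  let ?N = "Metric_space.packing_number (tree g) (tree_dist g) r"
  define U where "U = {i \<in> {1..n-1}. g (x (i + 1)) = g (x i) + r}"
  define D where "D = {i \<in> {1..n-1}. g (x i) = g (x (i + 1)) + r}"
  have x01: "x i \<in> {0..1}" if "1 \<le> i" "i \<le> n" for i
    using x that by (simp add: equal_steps_def)
  have U: "r \<le> exc_dist g (x (i + 1)) (x (k + 1))" if "i \<in> U" "k \<in> U" "i < k" for i k
  proof -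
    have "i + 1 \<le> k" "k + 1 \<le> n" "1 \<le> i" using that by (auto simp: U_def)
    then have "x (i + 1) \<le> x k" "x k \<le> x (k + 1)" "x (i + 1) \<le> x (k + 1)"
      by (auto intro: equal_steps_mono[OF x])
    moreover have "x (i + 1) \<in> {0..1}" "x (k + 1) \<in> {0..1}"
      using \<open>i + 1 \<le> k\<close> \<open>k + 1 \<le> n\<close> by (intro x01; simp)+
    ultimately have "g (x (i + 1)) + g (x (k + 1)) - 2 * g (x k) \<le> exc_dist g (x (i + 1)) (x (k + 1))"
      and "g (x (i + 1)) + g (x (k + 1)) - 2 * g (x (i + 1)) \<le> exc_dist g (x (i + 1)) (x (k + 1))"
      by (simp_all only: exc_dist_ge order_refl)
    \<comment> \<open>The average of these two bounds is \<open>g (x (k + 1)) - g (x k)\<close>.\<close>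
    then show ?thesis using that by (auto simp: U_def)
  qed
  have D: "r \<le> exc_dist g (x i) (x k)" if "i \<in> D" "k \<in> D" "i < k" for i k
  proof -
    have "i + 1 \<le> k" "k \<le> n" "1 \<le> i" using that by (auto simp: D_def)
    then have "x i \<le> x (i + 1)" "x (i + 1) \<le> x k" "x i \<le> x k"
      by (auto intro: equal_steps_mono[OF x])
    moreover have "x i \<in> {0..1}" "x k \<in> {0..1}"
      using \<open>i + 1 \<le> k\<close> \<open>k \<le> n\<close> \<open>1 \<le> i\<close> by (intro x01; simp)+
    ultimately have "g (x i) + g (x k) - 2 * g (x (i + 1)) \<le> exc_dist g (x i) (x k)"
      and "g (x i) + g (x k) - 2 * g (x k) \<le> exc_dist g (x i) (x k)"
      by (simp_all only: exc_dist_ge order_refl)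
    then show ?thesis using that by (auto simp: D_def)
  qed
  have "card U \<le> ?N * K ^ 2"
  proof (rule card_points_le_packing_number[OF K r r, where t = "\<lambda>i. x (i + 1)"])
    show "r \<le> exc_dist g (x (i + 1)) (x (k + 1))" if "i \<in> U" "k \<in> U" "i \<noteq> k" for i k
      using that U[of i k] U[of k i] exc_dist_commute[OF g, of "x (i + 1)"] by (metis nat_neq_iff)
  qed (use x01 in \<open>auto simp: U_def\<close>)
  moreover have "card D \<le> ?N * K ^ 2"
  proof (rule card_points_le_packing_number[OF K r r, where t = x])
    show "r \<le> exc_dist g (x i) (x k)" if "i \<in> D" "k \<in> D" "i \<noteq> k" for i k
      using that D[of i k] D[of k i] exc_dist_commute[OF g, of "x i"] by (metis nat_neq_iff)
  qed (use x01 in \<open>auto simp: D_def\<close>)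
  moreover have "{1..n-1} = U \<union> D" using x by (force simp: U_def D_def equal_steps_def)
  then have "n - 1 \<le> card U + card D" by (metis card_Un_le card_atLeastAtMost diff_Suc_1)
  ultimately show ?thesis by linarith
qed

text \<open>
  Since \<open>g\<close> takes values at least \<open>2 * r\<close> apart on \<open>[c, e]\<close>, at least one of them differs by
  \<open>r\<close> or more from the value at which the partition stands.
\<close>

lemma equal_steps_extend:
  assumes x: "equal_steps r n x" "n \<ge> 1" "x n \<le> c" and r: "r > 0"
    and ce: "c \<in> {0..1}" "e \<in> {0..1}" "c < e" "4 * r < exc_dist g c e"
  shows "\<exists>z \<le> e. equal_steps r (n + 1) (x(n + 1 := z))"
proof -
  obtain m where m: "m \<in> {min c e..max c e}" "(INF z\<in>{min c e..max c e}. g z) = g m"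
    using exc_min[OF g ce(1,2)] by metis
  have "4 * r < g c + g e - 2 * g m" using ce(4) unfolding exc_dist_def m(2) .
  then have "r \<le> \<bar>g c - g (x n)\<bar> \<or> r \<le> \<bar>g e - g (x n)\<bar> \<or> r \<le> \<bar>g m - g (x n)\<bar>" by argo
  moreover have "c \<le> m" "m \<le> e" using m(1) ce(3) by auto
  ultimately obtain w where w: "c \<le> w" "w \<le> e" "r \<le> \<bar>g w - g (x n)\<bar>"
    using ce(3) by (metis order_refl less_imp_le)
  have xn: "x n \<in> {0..1}" using x by (simp add: equal_steps_def)
  have "continuous_on {x n..w} g"
    by (rule continuous_on_subset[of "{0..1}"])
      (use g xn w ce in \<open>auto simp: excursion_def\<close>)
  then have "continuous_on {x n..w} (\<lambda>z. \<bar>g z - g (x n)\<bar>)" by (intro continuous_intros)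
  then obtain z where z: "x n \<le> z" "z \<le> w" "\<bar>g z - g (x n)\<bar> = r"
    using IVT'[of "\<lambda>z. \<bar>g z - g (x n)\<bar>" "x n" r w] w x(3) r by auto
  have "x n \<noteq> z" "z \<in> {0..1}" using z r xn w(2) ce(2) by auto
  then have "equal_steps r (n + 1) (x(n + 1 := z))"
    using x z xn w ce unfolding equal_steps_def by (auto simp: abs_minus_commute le_Suc_eq)
  then show ?thesis using z(2) w(2) by (intro exI[of _ z]) simp
qed

text \<open>
  The points of \<open>S\<close> are taken in increasing order, the first as the start and each later one
  for one more step. The bound by
  \<open>Max S\<close> keeps the partition behind the next point.
\<close>

lemma steps_through_separated_points:
  assumes r: "r > 0" and "finite S" "S \<noteq> {}" "S \<subseteq> {0..1}"
    and "\<And>x y. x \<in> S \<Longrightarrow> y \<in> S \<Longrightarrow> x \<noteq> y \<Longrightarrow> 4 * r < exc_dist g x y"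
  shows "\<exists>x. equal_steps r (card S) x \<and> x (card S) \<le> Max S"
  using assms(2-)
proof (induction S rule: finite_linorder_max_induct)
  case (insert b S)
  show ?case
  proof (cases "S = {}")
    case True
    then show ?thesis
      using insert.prems by (intro exI[of _ "\<lambda>_. b"]) (simp add: equal_steps_def)
  next
    case False
    then obtain x where x: "equal_steps r (card S) x" "x (card S) \<le> Max S"
      using insert by auto
    have Max: "Max S \<in> S" "Max S < b" using False insert.hyps by auto
    have b: "b \<notin> S" "Max (insert b S) = b"
      using insert.hyps Max False by (auto simp: Max_insert)
    have "card S \<ge> 1" using False insert.hyps(1) by (simp add: Suc_leI card_gt_0_iff)
    moreover have "Max S \<in> {0..1}" "b \<in> {0..1}" "4 * r < exc_dist g (Max S) b"
      using insert.prems Max by auto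
    ultimately obtain z where "z \<le> b" "equal_steps r (card S + 1) (x(card S + 1 := z))"
      using equal_steps_extend[OF x(1) _ x(2) r _ _ Max(2)] by blast
    then show ?thesis using b insert.hyps(1)
      by (intro exI[of _ "x(card S + 1 := z)"]) (simp del: fun_upd_apply add: fun_upd_same)
  qed
qed simp

section \<open>Comparison of variation and packing number\<close>

lemma discr_var_le_packing_number:
  assumes K: "Metric_space.doubling_with (tree g) (tree_dist g) K" and r: "r > 0"
  shows "discr_var r p g \<le>
    2 * real K ^ 2 * (real (Metric_space.packing_number (tree g) (tree_dist g) r) * r powr p)"
    (is "_ \<le> ?B")
proof (cases "step_sums r p g = {}")
  case False
  have "v \<le> ?B" if v: "v \<in> step_sums r p g" for v
  proof -
    obtain n x where "v = real (n - 1) * r powr p" and x: "equal_steps r n x"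
      using v unfolding step_sums_eq by blast
    moreover have "real (n - 1) \<le>
        real (2 * (Metric_space.packing_number (tree g) (tree_dist g) r * K ^ 2))"
      using step_count_le_packing_number[OF K r x] by (simp only: of_nat_le_iff)
    ultimately have "v \<le>
        real (2 * (Metric_space.packing_number (tree g) (tree_dist g) r * K ^ 2)) * r powr p"
      by (simp only: mult_right_mono powr_ge_zero)
    also have "\<dots> = ?B" by simp
    finally show ?thesis .
  qed
  then show ?thesis using False unfolding discr_var_def by (simp add: cSup_least)
qed (simp add: discr_var_def)

lemma packing_number_le_discr_var:
  assumes K: "Metric_space.doubling_with (tree g) (tree_dist g) K" and r: "r > 0"
    and c: "c \<in> {0..1}" "4 * r < g c"
  shows "real (Metric_space.packing_number (tree g) (tree_dist g) r) * r powr p \<le>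
    2 * real K ^ 4 * discr_var r p g"
proof -
  interpret T: Metric_space "tree g" "tree_dist g" by (rule Metric_space_tree[OF g])
  note tb = mtotally_bounded_tree[OF g]
  obtain S where S: "finite S" "S \<subseteq> {0..1}" "card S = T.packing_number r"
    "\<And>x y. x \<in> S \<Longrightarrow> y \<in> S \<Longrightarrow> x \<noteq> y \<Longrightarrow> r < exc_dist g x y"
    using packing_number_points[OF r] by metis
  have "card S \<le> T.packing_number (4 * r) * K ^ 4"
    by (rule card_points_le_packing_number[OF K _ r, where t = id])
      (use r S in \<open>auto simp: less_imp_le\<close>)
  then have scale: "T.packing_number r \<le> T.packing_number (4 * r) * K ^ 4" using S(3) by simp
  obtain S' where S': "finite S'" "S' \<subseteq> {0..1}" "card S' = T.packing_number (4 * r)"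
    "\<And>x y. x \<in> S' \<Longrightarrow> y \<in> S' \<Longrightarrow> x \<noteq> y \<Longrightarrow> 4 * r < exc_dist g x y"
    using packing_number_points[of "4 * r"] r by (metis mult_pos_pos zero_less_numeral)
  have two: "2 \<le> T.packing_number (4 * r)"
  proof -
    \<comment> \<open>The root, which is the class of \<open>0\<close>, and the class of \<open>c\<close> are at distance \<open>g c\<close>.\<close>
    have "g 0 = 0" using g by (simp add: excursion_def)
    then have far: "4 * r < tree_dist g (exc_rel g `` {0}) (exc_rel g `` {c})"
      using exc_dist_ge[of 0 c 0] tree_dist_class[OF g, of 0 c] c by simp
    have in_tree: "exc_rel g `` {0} \<in> tree g" "exc_rel g `` {c} \<in> tree g"
      using c by (auto intro: exc_class_in_tree)
    have "exc_rel g `` {0} \<noteq> exc_rel g `` {c}"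
      using far r T.zero[OF in_tree] by linarith
    then have "card {exc_rel g `` {0}, exc_rel g `` {c}} = 2"
      unfolding card_2_iff by blast
    moreover have "T.separated_by (4 * r) {exc_rel g `` {0}, exc_rel g `` {c}}"
      using far in_tree T.commute[of "exc_rel g `` {0}" "exc_rel g `` {c}"]
      unfolding T.separated_by_def by (metis empty_subsetI insert_iff insert_subset singletonD)
    ultimately show ?thesis
      using T.card_le_packing_number[OF tb, of "4 * r"] r
      by (metis finite.emptyI finite_insert mult_pos_pos zero_less_numeral)
  qed
  then have "S' \<noteq> {}" using S'(3) by auto
  then obtain x where "equal_steps r (card S') x"
    using steps_through_separated_points[OF r S'(1) _ S'(2,4)] by blast
  then have "real (card S' - 1) * r powr p \<in> step_sums r p g"
    using two S'(3) unfolding step_sums_eq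
    by (intro CollectI exI[of _ "card S'"] exI[of _ x]) simp
  then have V: "real (card S' - 1) * r powr p \<le> discr_var r p g"
    unfolding discr_var_def using cSup_upper[OF _ bdd_above_step_sums[OF g r]] by auto
  have "T.packing_number (4 * r) \<le> 2 * (card S' - 1)" using two S'(3) by simp
  then have "T.packing_number r \<le> 2 * (card S' - 1) * K ^ 4"
    using scale by (meson le_trans mult_le_mono1)
  then have "real (T.packing_number r) \<le> real (2 * (card S' - 1) * K ^ 4)"
    by (simp only: of_nat_le_iff)
  then have "real (T.packing_number r) * r powr p \<le> real (2 * (card S' - 1) * K ^ 4) * r powr p"
    by (simp only: mult_right_mono powr_ge_zero)
  also have "\<dots> = 2 * real K ^ 4 * (real (card S' - 1) * r powr p)" by simp
  also have "\<dots> \<le> 2 * real K ^ 4 * discr_var r p g"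
    by (rule mult_left_mono[OF V]) simp
  finally show ?thesis .
qed

end

lemma excursion_from_positive:
  assumes f: "circle_fun f" "\<not> f constant_on {0..1}" and a: "is_arg_min f (\<lambda>x. x \<in> {0..1}) a"
  obtains c where "c \<in> {0..1}" "0 < excursion_from a f c"
proof -
  have a01: "a \<in> {0..1}" and min: "\<And>x. x \<in> {0..1} \<Longrightarrow> f a \<le> f x"
    using a unfolding is_arg_min_def by (auto simp: not_less)
  obtain b where "b \<in> {0..1}" "f b \<noteq> f a"
    using f(2) unfolding constant_on_def by blast
  then have b: "b \<in> {0..1}" "f a < f b" using min[of b] by auto
  \<comment> \<open>The point \<open>b - a\<close> of the circle, represented in \<open>[0,1)\<close>.\<close>
  have "frac (frac (b - a) + a) = frac b" by (simp add: frac_def)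
  moreover have "f (frac b) = f b"
  proof (cases "b = 1")
    case True then show ?thesis using f(1) by (simp add: circle_fun_def)
  next
    case False then show ?thesis using b(1) by (simp add: frac_eq)
  qed
  ultimately have "0 < excursion_from a f (frac (b - a))"
    using b(2) by (simp add: excursion_from_def)
  moreover have "frac (b - a) \<in> {0..1}" using frac_lt_1[of "b - a"] by (simp add: less_imp_le)
  ultimately show thesis using that by blast
qed

theorem corollary4p7:
  fixes f :: "real \<Rightarrow> real" and a p :: real
  assumes "circle_fun f"
    and "\<not> f constant_on {0..1}"
    and "is_arg_min f (\<lambda>x. x \<in> {0..1}) a"
    and "Metric_space.doubling (tree (excursion_from a f)) (tree_dist (excursion_from a f))"
    and "p \<ge> 1"
  shows "\<exists>C>0. \<forall>\<epsilon>>0. \<exists>r0>0. \<forall>r. 0 < r \<and> r < r0 \<longrightarrow>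
    (let g = excursion_from a f;
         N = Metric_space.packing_number (tree g) (tree_dist g) r
     in inverse C * discr_var r p g - \<epsilon> \<le> real N * r powr p \<and>
        real N * r powr p \<le> C * discr_var r p g + \<epsilon>)"
proof -
  define g where "g = excursion_from a f"
  have g: "excursion g" unfolding g_def by (rule excursion_excursion_from[OF assms(1,3)])
  interpret T: Metric_space "tree g" "tree_dist g" by (rule Metric_space_tree[OF g])
  obtain c where c: "c \<in> {0..1}" "0 < g c"
    using excursion_from_positive[OF assms(1-3)] unfolding g_def by blast
  obtain K where K: "T.doubling_with K" "K \<ge> 1"
    using T.doubling_obtains assms(4) unfolding g_def[symmetric] by blast
  define C where "C = 2 * real K ^ 4"
  have C: "C > 0" using K(2) by (simp add: C_def)
  have bounds: "inverse C * discr_var r p g \<le> real (T.packing_number r) * r powr p"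
    "real (T.packing_number r) * r powr p \<le> C * discr_var r p g"
    if r: "0 < r" "r < g c / 4" for r
  proof -
    have "discr_var r p g \<le> 2 * real K ^ 2 * (real (T.packing_number r) * r powr p)"
      by (rule discr_var_le_packing_number[OF g K(1) r(1)])
    also have "\<dots> \<le> C * (real (T.packing_number r) * r powr p)"
      unfolding C_def using K(2)
      by (intro mult_right_mono mult_left_mono power_increasing) auto
    finally show "inverse C * discr_var r p g \<le> real (T.packing_number r) * r powr p"
      using C by (simp add: field_simps)
    show "real (T.packing_number r) * r powr p \<le> C * discr_var r p g"
      unfolding C_def
      by (rule packing_number_le_discr_var[OF g K(1) r(1) c(1)]) (use r(2) in simp)
  qed
  show ?thesis
    unfolding g_def[symmetric] Let_def
  proof (rule exI[of _ C], intro conjI allI impI, rule C, rule exI[of _ "g c / 4"],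
      intro conjI allI impI)
    fix \<epsilon> r :: real assume "0 < \<epsilon>" "0 < r \<and> r < g c / 4"
    then show "inverse C * discr_var r p g - \<epsilon> \<le> real (T.packing_number r) * r powr p"
      and "real (T.packing_number r) * r powr p \<le> C * discr_var r p g + \<epsilon>"
      using bounds[of r] by linarith+
  qed (use c in simp)
qed

end
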